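(* Let $w_1, w_2\in\mathbb{N}$ be odd and let $n\geq 0$ be an integer. Then (as polynomials in $x$) $$\sum_{i=0}^n\binom{n}{i}E_i(w_2x)\,T_{n-i}(w_1-1)\,w_1^iw_2^{n-i}=\sum_{i=0}^n\binom{n}{i}E_i(w_1x)\,T_{n-i}(w_2-1)\,w_2^iw_1^{n-i},$$ where $E_n(x)$ are the $n$-th ordinary Euler polynomials.
   Context: $\mathbb{N}$ denotes the positive integers. The ordinary Euler polynomials are given by $\frac{2e^{xt}}{e^t+1}=\sum_{n\ge0}E_n(x)\frac{t^n}{n!}$. For integers $k\ge 0$ and $n\ge0$, $T_k(n)=\sum_{l=0}^n(-1)^l l^k$, with the convention $0^0=1$. *)

theory Defs
  imports "HOL-Computational_Algebra.Computational_Algebra"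
begin

text \<open>
  The generating function \<open>2 * e^(x t) / (e^t + 1)\<close> as a formal power series in \<open>t\<close> whose
  coefficients are polynomials in \<open>x\<close>. As polynomials form no field, the quotient
  \<open>2 / (e^t + 1)\<close> is taken over the coefficient field and its coefficients are then read as
  constant polynomials; the second factor is \<open>e^(x t)\<close>, with coefficients \<open>x^k / k!\<close>.
\<close>

definition euler_gf :: "'a::field_char_0 poly fps" where
  "euler_gf = Abs_fps (\<lambda>k. [:fps_nth (2 / (fps_exp 1 + 1)) k:]) *
              Abs_fps (\<lambda>k. monom (1 / fact k) k)"

definition euler_poly :: "nat \<Rightarrow> 'a::field_char_0 poly" where
  "euler_poly n = smult (fact n) (fps_nth euler_gf n)"

definition alt_power_sum :: "nat \<Rightarrow> nat \<Rightarrow> int" where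
  "alt_power_sum k n = (\<Sum>l=0..n. (- 1) ^ l * int l ^ k)"

lemma euler_poly_generating_function:
  fixes x :: "'a::field_char_0"
  shows "Abs_fps (\<lambda>n. poly (euler_poly n) x / fact n) = 2 * fps_exp x / (fps_exp 1 + 1)"
proof -
  have "fps_nth (fps_exp 1 + 1 :: 'a fps) 0 \<noteq> 0"
    by simp
  then have div: "f / (fps_exp 1 + 1) = f * inverse (fps_exp 1 + 1)" for f :: "'a fps"
    by (rule fps_divide_unit)
  have "Abs_fps (\<lambda>n. poly (euler_poly n) x / fact n) = 2 / (fps_exp 1 + 1) * fps_exp x"
    by (rule fps_ext)
      (simp add: euler_poly_def euler_gf_def fps_mult_nth poly_sum poly_monom)
  also have "\<dots> = 2 * fps_exp x / (fps_exp 1 + 1)"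
    unfolding div by (simp only: mult_ac)
  finally show ?thesis .
qed

end

theory Submission
  imports Defs
begin

text \<open>
  Up to the factor \<open>n!\<close>, the left-hand side is the coefficient of \<open>t^n\<close> in the product of
  \<open>2 e^(w1 w2 x t) / (e^(w1 t) + 1)\<close> and the alternating geometric sum
  \<open>\<Sum>l<w1. (- e^(w2 t))^l\<close>. As \<open>w1\<close> is odd, the latter equals
  \<open>(e^(w1 w2 t) + 1) / (e^(w2 t) + 1)\<close>, so the product is symmetric in \<open>w1\<close> and \<open>w2\<close>.
\<close>

definition euler_fps :: "'a::field_char_0 \<Rightarrow> 'a \<Rightarrow> 'a fps" where
  "euler_fps c y = Abs_fps (\<lambda>n. poly (euler_poly n) y * c ^ n / fact n)"

definition alt_power_sum_fps :: "nat \<Rightarrow> 'a::field_char_0 \<Rightarrow> 'a fps" where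
  "alt_power_sum_fps m c = Abs_fps (\<lambda>k. of_int (alt_power_sum k m) * c ^ k / fact k)"

lemma fps_exp_plus_1_neq_0: "fps_exp (c::'a::field_char_0) + 1 \<noteq> 0"
proof
  assume "fps_exp c + 1 = 0"
  then have "fps_nth (fps_exp c + 1) 0 = 0" by simp
  then show False by simp
qed

text \<open>Substituting \<open>c * t\<close> for \<open>t\<close> in the Euler generating function
  turns it into \<open>euler_fps c y\<close>. The denominator is cleared first, so that only
  products and sums have to commute with the substitution.\<close>

lemma euler_fps_mult_exp_plus_1:
  "euler_fps c y * (fps_exp c + 1) = 2 * fps_exp (c * y)"
proof -
  let ?G = "Abs_fps (\<lambda>n. poly (euler_poly n) y / fact n)"
  let ?X = "fps_const c * fps_X"
  have "?G * (fps_exp 1 + 1) = 2 * fps_exp y"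
    unfolding euler_poly_generating_function
    by (simp add: fps_divide_unit mult.assoc inverse_mult_eq_1)
  then have "(?G * (fps_exp 1 + 1)) oo ?X = (fps_const 2 * fps_exp y) oo ?X"
    by (simp add: numeral_fps_const)
  moreover have "?G oo ?X = euler_fps c y"
    by (rule fps_ext) (simp add: euler_fps_def fps_nth_compose_linear)
  moreover have "fps_exp d oo ?X = fps_exp (c * d)" for d
    by (rule fps_ext) (simp add: fps_nth_compose_linear power_mult_distrib)
  ultimately show ?thesis
    by (simp add: fps_compose_mult_distrib fps_compose_add_distrib numeral_fps_const)
qed

text \<open>Expanding \<open>(-1)^l * e^(l c t)\<close> gives the coefficient
  \<open>(-1)^l * (l c)^k / k!\<close>; summing over \<open>l\<close> makes the power sum
  appear.\<close>

lemma alt_power_sum_fps_eq: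
  "alt_power_sum_fps m c = (\<Sum>l\<le>m. (- fps_exp c) ^ l)"
proof (rule fps_ext)
  fix k
  have "(- fps_exp c) ^ l = fps_const ((- 1) ^ l) * fps_exp (of_nat l * c)" for l
    by (subst power_minus) (simp add: fps_exp_power_mult flip: fps_const_power fps_const_neg)
  then show "fps_nth (alt_power_sum_fps m c) k = fps_nth (\<Sum>l\<le>m. (- fps_exp c) ^ l) k"
    by (simp add: alt_power_sum_fps_def alt_power_sum_def fps_sum_nth sum_distrib_right
        sum_divide_distrib power_mult_distrib atLeast0AtMost mult.assoc)
qed

lemma alt_power_sum_fps_mult_exp_plus_1:
  assumes "odd w"
  shows "alt_power_sum_fps (w - 1) c * (fps_exp c + 1) = fps_exp (of_nat w * c) + 1"
proof -
  \<comment> \<open>Oddness excludes \<open>w = 0\<close>, where truncated subtraction would leave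
    the extra index 0.\<close>
  have "{..w - 1} = {..<w}"
    using assms by (cases w) auto
  then have "alt_power_sum_fps (w - 1) c * (fps_exp c + 1) = 1 - (- fps_exp c) ^ w"
    using one_diff_power_eq[of "- fps_exp c" w] by (simp add: alt_power_sum_fps_eq mult.commute)
  then show ?thesis
    using assms by (simp add: fps_exp_power_mult)
qed

lemma euler_fps_mult_alt_power_sum_fps_sym:
  fixes x :: "'a::field_char_0"
  assumes "odd w1" and "odd w2"
  shows "euler_fps (of_nat w1) (of_nat w2 * x) * alt_power_sum_fps (w1 - 1) (of_nat w2) =
         euler_fps (of_nat w2) (of_nat w1 * x) * alt_power_sum_fps (w2 - 1) (of_nat w1)"
    (is "?E1 * ?T1 = ?E2 * ?T2")
proof -
  let ?D1 = "fps_exp (of_nat w1 :: 'a) + 1" and ?D2 = "fps_exp (of_nat w2 :: 'a) + 1"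
  \<comment> \<open>The pairing is crossed: \<open>?D1\<close> is the denominator of
    \<open>?E1\<close>, but \<open>?D2\<close> is that of the geometric sum \<open>?T1\<close>. Both
    sides become \<open>2 e^(w1 w2 x t) (e^(w1 w2 t) + 1)\<close>, and the nonzero factors
    \<open>?D1\<close> and \<open>?D2\<close> cancel.\<close>
  have "(?E1 * ?T1) * (?D1 * ?D2) = (?E1 * ?D1) * (?T1 * ?D2)"
    by (simp only: mult_ac)
  also have "\<dots> = (?E2 * ?D2) * (?T2 * ?D1)"
    unfolding euler_fps_mult_exp_plus_1 alt_power_sum_fps_mult_exp_plus_1[OF assms(1)]
      alt_power_sum_fps_mult_exp_plus_1[OF assms(2)]
    by (simp only: mult_ac)
  also have "\<dots> = (?E2 * ?T2) * (?D1 * ?D2)"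
    by (simp only: mult_ac)
  finally show ?thesis
    using fps_exp_plus_1_neq_0[of "of_nat w1 :: 'a"] fps_exp_plus_1_neq_0[of "of_nat w2 :: 'a"]
    by simp
qed

text \<open>This is the Cauchy product, with \<open>n choose i = n! / (i! (n-i)!)\<close>.
  Evaluation at \<open>x\<close> turns the composition into the value at \<open>b * x\<close>, so
  the series have scalar coefficients.\<close>

lemma poly_sum_euler_poly_alt_power_sum:
  fixes x :: "'a::field_char_0"
  shows "poly (\<Sum>i=0..n. of_nat (n choose i) * (euler_poly i \<circ>\<^sub>p [:0, of_nat b:])
           * of_int (alt_power_sum (n - i) m) * of_nat a ^ i * of_nat b ^ (n - i)) x =
         fact n * fps_nth (euler_fps (of_nat a) (of_nat b * x) * alt_power_sum_fps m (of_nat b)) n"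
  unfolding fps_mult_nth sum_distrib_left poly_sum
  by (rule sum.cong)
    (simp_all add: euler_fps_def alt_power_sum_fps_def poly_pcompose binomial_fact
      mult.commute mult.left_commute)

theorem theorem5:
  fixes w1 w2 n :: nat
  assumes "odd w1" and "odd w2"
  shows
    "(\<Sum>i=0..n. of_nat (n choose i) * (euler_poly i \<circ>\<^sub>p [:0, of_nat w2:])
        * of_int (alt_power_sum (n - i) (w1 - 1)) * of_nat w1 ^ i * of_nat w2 ^ (n - i)) =
     (\<Sum>i=0..n. of_nat (n choose i) * (euler_poly i \<circ>\<^sub>p [:0, of_nat w1:])
        * of_int (alt_power_sum (n - i) (w2 - 1)) * of_nat w2 ^ i * of_nat w1 ^ (n - i)
        :: 'a::field_char_0 poly)"
  \<comment> \<open>A field of characteristic 0 is infinite, so polynomials that agree at every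
    point are equal.\<close>
  by (rule poly_eq_poly_eq_iff[THEN iffD1, OF ext])
    (simp only: poly_sum_euler_poly_alt_power_sum euler_fps_mult_alt_power_sum_fps_sym[OF assms])

end
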